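(* Let $L$ be a finite-dimensional Leibniz algebra over $\mathbb{C}$ which admits a non-degenerate (i.e. invertible as a linear operator) derivation. Then $L$ is a nilpotent algebra.
   Context: A (right) Leibniz algebra over a field $F$ is an $F$-vector space $L$ with a bilinear multiplication $[-,-]$ satisfying $[[x,y],z]=[[x,z],y]+[x,[y,z]]$ for all $x,y,z\in L$. A derivation of $L$ is a linear map $d\colon L\to L$ with $d([x,y])=[d(x),y]+[x,d(y)]$ for all $x,y\in L$. The lower central series is defined by $L^1=L$ and $L^{n+1}=[L^n,L]$ for $n\ge 1$, where $[U,V]$ denotes the linear span of all products $[u,v]$ with $u\in U$, $v\in V$; $L$ is nilpotent if $L^k=0$ for some $k\in\mathbb{N}$. *)

theory Defs
  imports Complex_Main
begin

locale leibniz_algebra = vector_space scale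
  for scale :: "'f::field \<Rightarrow> 'a::ab_group_add \<Rightarrow> 'a" +
  fixes bracket :: "'a \<Rightarrow> 'a \<Rightarrow> 'a"
  assumes linear_bracket_left: "Vector_Spaces.linear scale scale (\<lambda>x. bracket x y)"
    and linear_bracket_right: "Vector_Spaces.linear scale scale (\<lambda>y. bracket x y)"
    and leibniz_identity:
      "bracket (bracket x y) z = bracket (bracket x z) y + bracket x (bracket y z)"
begin

definition set_bracket :: "'a set \<Rightarrow> 'a set \<Rightarrow> 'a set" where
  "set_bracket U V = span {bracket u v | u v. u \<in> U \<and> v \<in> V}"

text \<open>The series starts at index 1; the value at index 0 is a dummy that
  \<open>nilpotent\<close> does not use.\<close>

fun lower_central :: "nat \<Rightarrow> 'a set" where
  "lower_central 0 = UNIV"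
| "lower_central (Suc 0) = UNIV"
| "lower_central (Suc (Suc n)) = set_bracket (lower_central (Suc n)) UNIV"

definition nilpotent :: bool where
  "nilpotent \<longleftrightarrow> (\<exists>k\<ge>1. lower_central k = {0})"

definition derivation :: "('a \<Rightarrow> 'a) \<Rightarrow> bool" where
  "derivation d \<longleftrightarrow> Vector_Spaces.linear scale scale d \<and>
     (\<forall>x y. d (bracket x y) = bracket (d x) y + bracket x (d y))"

end

end

(* The generalized eigenspaces L(\<alpha>) of the derivation span L and satisfy
   [L(\<alpha>), L(\<beta>)] \<le> L(\<alpha> + \<beta>), and 0 is not an eigenvalue. As there are finitely many
   eigenvalues, right multiplication by a homogeneous element h of weight \<beta> \<noteq> 0 shifts
   weights by \<beta> and so is nilpotent. By Jacobson's argument for weakly closed sets, nilpotent right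
   multiplications by a bracket-closed spanning set H force L to be nilpotent: a
   proper subalgebra K that contains the right annihilator, is generated modulo it by
   elements of H and acts nilpotently on L is normalised by some h \<in> H outside
   K (take a longest word [h, k1, ..., ki] of elements of H that stays outside K),
   and then K + F h acts nilpotently as well, so that a K of maximal dimension is L. *)
theory Submission
  imports Defs "HOL-Computational_Algebra.Fundamental_Theorem_Algebra"
begin

section \<open>The right annihilator as a substitute for antisymmetry\<close>

context leibniz_algebra
begin

lemma bracket_add_left: "bracket (x + y) z = bracket x z + bracket y z"
  and bracket_scale_left: "bracket (scale c x) z = scale c (bracket x z)"
  using linear_bracket_left[of z] by (simp_all add: Vector_Spaces.linear_iff_module_hom module_hom_iff)

lemma bracket_add_right: "bracket z (x + y) = bracket z x + bracket z y"
  and bracket_scale_right: "bracket z (scale c x) = scale c (bracket z x)"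
  using linear_bracket_right[of z] by (simp_all add: Vector_Spaces.linear_iff_module_hom module_hom_iff)

lemma bracket_zero_left [simp]: "bracket 0 z = 0"
  using bracket_scale_left[of 0 0 z] by simp

lemma bracket_zero_right [simp]: "bracket z 0 = 0"
  using bracket_scale_right[of z 0 0] by simp

definition right_annihilator :: "'a set" where
  "right_annihilator = {z. \<forall>x. bracket x z = 0}"

lemma subspace_right_annihilator: "subspace right_annihilator"
  unfolding subspace_def right_annihilator_def
  by (simp add: bracket_add_right bracket_scale_right)

text \<open>Adding the Leibniz identities for w, x, y and for w, y, x cancels
  \<open>[[w,x],y]\<close> and \<open>[[w,y],x]\<close>. So the bracket is antisymmetric modulo the
  annihilator.\<close>

lemma bracket_symmetrised_in_right_annihilator:
  "bracket x y + bracket y x \<in> right_annihilator"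
proof -
  have "bracket w (bracket x y) + bracket w (bracket y x) = 0" for w
    using leibniz_identity[of w x y] leibniz_identity[of w y x]
    by (simp add: algebra_simps)
  then show ?thesis
    by (simp add: right_annihilator_def bracket_add_right)
qed

text \<open>In the identity for w, x, x two terms coincide. This covers characteristic 2 as well,
  where halving the symmetrised bracket would fail.\<close>

lemma bracket_self_in_right_annihilator: "bracket x x \<in> right_annihilator"
  using leibniz_identity[of _ x x] by (simp add: right_annihilator_def)

text \<open>In the identity for w, z, x all terms but \<open>[w,[z,x]]\<close> vanish. Hence the
  annihilator is a subalgebra, the starting point of the dimension argument.\<close>

lemma bracket_right_annihilator_left:
  assumes "z \<in> right_annihilator"
  shows "bracket z x \<in> right_annihilator"
  using leibniz_identity[of _ z x] assms by (simp add: right_annihilator_def)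

section \<open>Spans of words whose right factors lie in a set K\<close>

fun right_power :: "'a set \<Rightarrow> nat \<Rightarrow> 'a set" where
  "right_power K 0 = UNIV"
| "right_power K (Suc n) = set_bracket (right_power K n) K"

text \<open>The lower central series is counted from 1, while n here counts the right factors of a
  word.\<close>

lemma lower_central_Suc_eq_right_power: "lower_central (Suc n) = right_power UNIV n"
  by (induction n) simp_all

lemma subspace_right_power: "subspace (right_power K n)"
  by (cases n) (simp_all add: set_bracket_def)

lemma bracket_in_right_power:
  "u \<in> right_power K n \<Longrightarrow> k \<in> K \<Longrightarrow> bracket u k \<in> right_power K (Suc n)"
  by (auto simp: set_bracket_def intro!: span_base)

lemma right_power_Suc_subset:
  assumes "subspace S" and "\<And>u k. u \<in> right_power K n \<Longrightarrow> k \<in> K \<Longrightarrow> bracket u k \<in> S"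
  shows "right_power K (Suc n) \<subseteq> S"
  unfolding right_power.simps set_bracket_def using assms by (intro span_minimal) auto

lemma right_power_antimono: "right_power K (Suc n) \<subseteq> right_power K n"
proof (induction n)
  case (Suc n)
  then show ?case
    by (intro right_power_Suc_subset subspace_right_power bracket_in_right_power) auto
qed simp

text \<open>By the Leibniz identity right multiplication by h is a derivation:
  \<open>[[u,k],h] = [[u,h],k] + [u,[k,h]]\<close>, and both summands are again words ending in an
  element of K.\<close>

lemma right_power_normalised:
  assumes "\<And>k. k \<in> K \<Longrightarrow> bracket k h \<in> K" and "u \<in> right_power K n"
  shows "bracket u h \<in> right_power K n"
  using assms(2)
proof (induction n arbitrary: u)
  case (Suc n)
  have "right_power K (Suc n) \<subseteq> {u. bracket u h \<in> right_power K (Suc n)}"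
  proof (rule right_power_Suc_subset)
    show "subspace {u. bracket u h \<in> right_power K (Suc n)}"
      unfolding subspace_def
      by (simp add: bracket_add_left bracket_scale_left subspace_0 subspace_add subspace_scale
          subspace_right_power del: right_power.simps)
  next
    fix u k assume u: "u \<in> right_power K n" and k: "k \<in> K"
    have "bracket (bracket u h) k \<in> right_power K (Suc n)"
      "bracket u (bracket k h) \<in> right_power K (Suc n)"
      using Suc.IH u k assms(1) by (auto intro!: bracket_in_right_power simp del: right_power.simps)
    then show "bracket u k \<in> {u. bracket u h \<in> right_power K (Suc n)}"
      using leibniz_identity[of u k h] subspace_add[OF subspace_right_power]
      by (simp del: right_power.simps)
  qed
  with Suc.prems show ?case by blast
qed simp

lemma right_mult_power_add:
  "((\<lambda>x. bracket x h) ^^ m) (x + y) = ((\<lambda>x. bracket x h) ^^ m) x + ((\<lambda>x. bracket x h) ^^ m) y"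
  by (induction m) (simp_all add: bracket_add_left)

lemma right_mult_power_scale:
  "((\<lambda>x. bracket x h) ^^ m) (scale c x) = scale c (((\<lambda>x. bracket x h) ^^ m) x)"
  by (induction m) (simp_all add: bracket_scale_left)

lemma right_mult_power_zero: "((\<lambda>x. bracket x h) ^^ m) 0 = 0"
  by (induction m) simp_all

text \<open>On each quotient of consecutive right powers of \<open>K\<close>, the subspace \<open>K\<close> acts as zero,
  so a word in \<open>K + F h\<close> acts there like a multiple of a power of \<open>h\<close>.\<close>

lemma right_power_extend:
  assumes K: "subspace K"
    and norm: "\<And>k. k \<in> K \<Longrightarrow> bracket k h \<in> K"
    and nil: "\<And>x. ((\<lambda>x. bracket x h) ^^ m) x = 0"
    and zero: "right_power K n = {0}"
  shows "right_power {k + scale c h | k c. k \<in> K} (n * m) = {0}"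
proof -
  define K' where "K' = {k + scale c h | k c. k \<in> K}"
  define R where "R = (\<lambda>j. ((\<lambda>x. bracket x h) ^^ j))"
  have R_inv: "R j u \<in> right_power K i" if "u \<in> right_power K i" for i j u
    using that unfolding R_def by (induction j) (auto intro: right_power_normalised[OF norm])
  \<comment> \<open>Call \<open>right_power K i\<close> layer i. After j more factors from
    \<open>K'\<close>, a word in layer i is, modulo layer i+1, a j-fold right multiplication by h; b
    absorbs the scalars.\<close>
  have step: "right_power K' (N + j) \<subseteq>
      {a + R j b | a b. a \<in> right_power K (Suc i) \<and> b \<in> right_power K i}"
    (is "_ \<subseteq> ?S j") if N: "right_power K' N \<subseteq> right_power K i" for N i j
  proof (induction j)
    case 0
    show ?case
    proof
      fix x assume "x \<in> right_power K' (N + 0)"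
      then have "x = 0 + R 0 x" "x \<in> right_power K i" using N by (auto simp: R_def)
      then show "x \<in> ?S 0"
        using subspace_0[OF subspace_right_power] by blast
    qed
  next
    case (Suc j)
    have "right_power K' (Suc (N + j)) \<subseteq> ?S (Suc j)"
    proof (rule right_power_Suc_subset)
      show "subspace (?S (Suc j))"
      proof (rule subspaceI)
        have "0 = 0 + R (Suc j) 0" unfolding R_def right_mult_power_zero by simp
        then show "0 \<in> ?S (Suc j)" using subspace_0[OF subspace_right_power] by blast
      next
        fix x y assume "x \<in> ?S (Suc j)" "y \<in> ?S (Suc j)"
        then obtain a b a' b' where ab: "x = a + R (Suc j) b" "y = a' + R (Suc j) b'"
          and mem: "a \<in> right_power K (Suc i)" "b \<in> right_power K i"
            "a' \<in> right_power K (Suc i)" "b' \<in> right_power K i" by blast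
        have "x + y = (a + a') + R (Suc j) (b + b')"
          unfolding ab R_def right_mult_power_add by (simp add: algebra_simps)
        then show "x + y \<in> ?S (Suc j)"
          using mem subspace_add[OF subspace_right_power] by blast
      next
        fix c x assume "x \<in> ?S (Suc j)"
        then obtain a b where ab: "x = a + R (Suc j) b"
          and mem: "a \<in> right_power K (Suc i)" "b \<in> right_power K i" by blast
        have "scale c x = scale c a + R (Suc j) (scale c b)"
          unfolding ab R_def right_mult_power_scale by (simp add: scale_right_distrib)
        then show "scale c x \<in> ?S (Suc j)"
          using mem subspace_scale[OF subspace_right_power] by blast
      qed
    next
      fix u k assume "u \<in> right_power K' (N + j)" and "k \<in> K'"
      then obtain a b k' c where u: "u = a + R j b" and k: "k = k' + scale c h" "k' \<in> K"
        and a: "a \<in> right_power K (Suc i)" and b: "b \<in> right_power K i"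
        using Suc.IH unfolding K'_def by blast
      \<comment> \<open>All of \<open>?A\<close> lies in layer i+1: a is already there, h preserves
        the layer, and a factor \<open>k'\<close> descends by one. Only the product of
        \<open>R j b\<close> with h is left over.\<close>
      let ?A = "bracket a k' + scale c (bracket a h) + bracket (R j b) k'"
      have "bracket u k = ?A + R (Suc j) (scale c b)"
        unfolding R_def right_mult_power_scale
        by (simp add: u k R_def bracket_add_left bracket_add_right bracket_scale_right
            scale_right_distrib add_ac)
      moreover have "?A \<in> right_power K (Suc i)"
        using k(2) a b right_power_antimono[of K i]
        by (intro subspace_add subspace_scale subspace_right_power right_power_normalised[OF norm]
            bracket_in_right_power R_inv) auto
      moreover have "scale c b \<in> right_power K i"
        using b subspace_scale[OF subspace_right_power] by blast
      ultimately show "bracket u k \<in> ?S (Suc j)" by blast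
    qed
    then show ?case by simp
  qed
  \<comment> \<open>For j = m the power of h vanishes, so every m factors from \<open>K'\<close>
    descend one layer.\<close>
  have "right_power K' (i * m) \<subseteq> right_power K i" for i
  proof (induction i)
    case (Suc i)
    show ?case
      using step[OF Suc, of m] nil unfolding R_def by (auto simp: add.commute)
  qed simp
  with zero have "right_power K' (n * m) \<subseteq> {0}" by metis
  then show ?thesis
    using subspace_0[OF subspace_right_power[of K']] unfolding K'_def by blast
qed

end

section \<open>Jacobson's argument for a bracket-closed spanning set\<close>

locale finite_dimensional_leibniz_algebra =
  leibniz_algebra scale bracket + finite_dimensional_vector_space scale Basis
  for scale :: "'f::field \<Rightarrow> 'a::ab_group_add \<Rightarrow> 'a"
    and bracket :: "'a \<Rightarrow> 'a \<Rightarrow> 'a"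
    and Basis :: "'a set"
begin

theorem nilpotent_if_spanned_by_nilpotents:
  assumes closed: "\<And>x y. x \<in> H \<Longrightarrow> y \<in> H \<Longrightarrow> bracket x y \<in> H"
    and span_H: "span H = UNIV"
    and nil: "\<And>h. h \<in> H \<Longrightarrow> \<exists>m. \<forall>x. ((\<lambda>x. bracket x h) ^^ m) x = 0"
  shows nilpotent
proof -
  let ?Z = right_annihilator
  \<comment> \<open>Containing \<open>?Z\<close> lets K absorb every failure of antisymmetry.
    Generation by H is asked only modulo \<open>?Z\<close>, as nothing makes \<open>?Z\<close>
    itself spanned by elements of H.\<close>
  define good where "good K \<longleftrightarrow> subspace K \<and> ?Z \<subseteq> K \<and>
      (\<forall>x\<in>K. \<forall>y\<in>K. bracket x y \<in> K) \<and> K \<subseteq> span (K \<inter> H \<union> ?Z) \<and>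
      (\<exists>n. right_power K n = {0})" for K
  have good_Z: "good ?Z"
  proof -
    have "right_power ?Z 1 \<subseteq> {0}"
      unfolding One_nat_def
      by (rule right_power_Suc_subset) (auto simp: right_annihilator_def)
    then have "right_power ?Z 1 = {0}"
      using subspace_0[OF subspace_right_power[of ?Z 1]] by blast
    then show ?thesis
      unfolding good_def using bracket_right_annihilator_left subspace_right_annihilator
      by (auto intro: span_base simp del: right_power.simps)
  qed
  have extend: "\<exists>K'. good K' \<and> dim K < dim K'" if good: "good K" and "K \<noteq> UNIV" for K
  proof -
    from good obtain n where K: "subspace K" "?Z \<subseteq> K" "K \<subseteq> span (K \<inter> H \<union> ?Z)"
      and KK: "\<And>x y. x \<in> K \<Longrightarrow> y \<in> K \<Longrightarrow> bracket x y \<in> K"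
      and n: "right_power K n = {0}" unfolding good_def by blast
    have "\<exists>h \<in> H - K. \<forall>k \<in> K \<inter> H. bracket h k \<in> K"
    proof (rule ccontr)
      assume *: "\<not> ?thesis"
      \<comment> \<open>Without such an h, words outside K could be lengthened forever. The start
        uses that H spans L and K is proper; at length n the word is 0, which lies in K.\<close>
      have "\<exists>h \<in> H - K. h \<in> right_power K i" for i
      proof (induction i)
        case 0
        have "\<not> H \<subseteq> K"
          using span_minimal[of H K] K(1) span_H that(2) by blast
        then show ?case by auto
      next
        case (Suc i)
        then obtain h where h: "h \<in> H - K" "h \<in> right_power K i" by blast
        with * obtain k where "k \<in> K \<inter> H" "bracket h k \<notin> K" by blast
        with h show ?case
          using closed bracket_in_right_power[of h K i k] by blast
      qed
      from this[of n] show False using n subspace_0[OF K(1)] by auto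
    qed
    then obtain h where h: "h \<in> H" "h \<notin> K" and hk: "\<And>k. k \<in> K \<inter> H \<Longrightarrow> bracket h k \<in> K"
      by blast
    \<comment> \<open>The condition is linear in k and trivial on \<open>?Z\<close>, so it passes
      from the generators to all of K.\<close>
    have "subspace {k. bracket h k \<in> K}"
      using K(1) unfolding subspace_def by (simp add: bracket_add_right bracket_scale_right)
    moreover have "K \<inter> H \<union> ?Z \<subseteq> {k. bracket h k \<in> K}"
      using hk subspace_0[OF K(1)] by (auto simp: right_annihilator_def)
    ultimately have hK: "bracket h k \<in> K" if "k \<in> K" for k
      using span_minimal K(3) that by blast
    \<comment> \<open>\<open>[k,h]\<close> is a symmetrised bracket, which lies in \<open>?Z\<close>
      and so in K, minus \<open>[h,k]\<close>.\<close>
    have Kh: "bracket k h \<in> K" if "k \<in> K" for k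
      using subspace_diff[OF K(1) subsetD[OF K(2) bracket_symmetrised_in_right_annihilator[of k h]]
          hK[OF that]] by simp
    define K' where "K' = {k + scale c h | k c. k \<in> K}"
    have K'I: "k + scale c h \<in> K'" if "k \<in> K" for k c
      using that unfolding K'_def by blast
    have sub: "K \<subseteq> K'" using K'I[of _ 0] by auto
    have h': "h \<in> K'" using K'I[OF subspace_0[OF K(1)], of 1] by simp
    have K': "subspace K'"
    proof (rule subspaceI)
      show "0 \<in> K'" using sub subspace_0[OF K(1)] by blast
    next
      fix x y assume "x \<in> K'" "y \<in> K'"
      then obtain k c k' c' where "x = k + scale c h" "y = k' + scale c' h" "k \<in> K" "k' \<in> K"
        unfolding K'_def by blast
      then show "x + y \<in> K'"
        using K'I[OF subspace_add[OF K(1)], of k k' "c + c'"]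
        by (simp add: scale_left_distrib algebra_simps)
    next
      fix a x assume "x \<in> K'"
      then obtain k c where "x = k + scale c h" "k \<in> K" unfolding K'_def by blast
      then show "scale a x \<in> K'"
        using K'I[OF subspace_scale[OF K(1)], of k a "a * c"]
        by (simp add: scale_right_distrib)
    qed
    have "bracket x y \<in> K'" if "x \<in> K'" "y \<in> K'" for x y
    proof -
      from that obtain k c k' c' where xy: "x = k + scale c h" "y = k' + scale c' h"
        and k: "k \<in> K" "k' \<in> K"
        unfolding K'_def by blast
      \<comment> \<open>With the square of h in K, all brackets of elements of \<open>K'\<close>
        even fall into K.\<close>
      have "bracket h h \<in> K" using K(2) bracket_self_in_right_annihilator by blast
      then have "bracket x y \<in> K"
        unfolding xy bracket_add_left bracket_add_right bracket_scale_left bracket_scale_right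
        using k hK Kh KK by (simp add: subspace_add[OF K(1)] subspace_scale[OF K(1)])
      then show ?thesis using sub by blast
    qed
    moreover have "K' \<subseteq> span (K' \<inter> H \<union> ?Z)"
    proof -
      have "K \<subseteq> span (K' \<inter> H \<union> ?Z)"
        using K(3) span_mono[of "K \<inter> H \<union> ?Z" "K' \<inter> H \<union> ?Z"] sub by blast
      moreover have "h \<in> span (K' \<inter> H \<union> ?Z)" using h h' by (auto intro: span_base)
      ultimately show ?thesis unfolding K'_def by (auto intro: span_add span_scale)
    qed
    moreover obtain m where "\<And>x. ((\<lambda>x. bracket x h) ^^ m) x = 0" using nil[OF h(1)] by blast
    then have "right_power K' (n * m) = {0}"
      unfolding K'_def using right_power_extend[OF K(1) Kh _ n] by blast
    ultimately have "good K'"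
      unfolding good_def using K' K(2) sub by blast
    moreover have "dim K < dim K'"
      using dim_psubset[of K K'] sub h h' span_eq_iff[THEN iffD2, OF K(1)]
        span_eq_iff[THEN iffD2, OF K'] by blast
    ultimately show ?thesis by blast
  qed
  \<comment> \<open>Each extension raises the dimension, so asking for more than
    \<open>dimension\<close> leaves only the whole algebra.\<close>
  have "\<exists>K. good K \<and> (K = UNIV \<or> i \<le> dim K)" for i
  proof (induction i)
    case 0
    then show ?case using good_Z by blast
  next
    case (Suc i)
    then show ?case using extend by (metis Suc_leI le_less_trans)
  qed
  from this[of "Suc dimension"] have "good UNIV"
    using dim_subset_UNIV by (metis not_less_eq_eq)
  then obtain n where "right_power UNIV n = {0}" unfolding good_def by blast
  then have "lower_central (Suc n) = {0}" by (simp only: lower_central_Suc_eq_right_power)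
  then show ?thesis unfolding nilpotent_def by (metis Suc_le_mono le0 One_nat_def)
qed

end

section \<open>Linear dependence of long sequences\<close>

context finite_dimensional_vector_space
begin

text \<open>Sequences rather than sets, because iterates of an operator may repeat; a repetition
  gives the relation with coefficients 1 and -1.\<close>

lemma sequence_dependent:
  fixes x :: "nat \<Rightarrow> 'b"
  shows "\<exists>c. (\<exists>i\<le>dimension. c i \<noteq> 0) \<and> (\<Sum>i\<le>dimension. scale (c i) (x i)) = 0"
proof (cases "inj_on x {..dimension}")
  case True
  have "card (x ` {..dimension}) = Suc dimension"
    by (simp add: card_image[OF True])
  then have "dependent (x ` {..dimension})"
    using independent_card_le_dim[of "x ` {..dimension}" UNIV]
    by (metis dim_UNIV dimension_def not_less_eq_eq order_refl subset_UNIV)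
  then obtain u where u: "\<exists>v\<in>x ` {..dimension}. u v \<noteq> 0"
    and "(\<Sum>v\<in>x ` {..dimension}. scale (u v) v) = 0"
    by (auto simp: dependent_finite)
  then have "(\<Sum>i\<le>dimension. scale (u (x i)) (x i)) = 0"
    by (simp add: sum.reindex[OF True])
  then show ?thesis using u by (intro exI[of _ "\<lambda>i. u (x i)"]) auto
next
  case False
  then obtain i j where ij: "i \<le> dimension" "j \<le> dimension" "i \<noteq> j" "x i = x j"
    by (auto simp: inj_on_def)
  let ?c = "\<lambda>k. (if k = i then 1 else 0) - (if k = j then 1 else 0)"
  have "(\<Sum>k\<le>dimension. scale (?c k) (x k)) =
      (\<Sum>k\<le>dimension. if k = i then x k else 0) - (\<Sum>k\<le>dimension. if k = j then x k else 0)"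
    unfolding sum_subtractf[symmetric] by (intro sum.cong) (auto simp: scale_left_diff_distrib)
  also have "\<dots> = 0" using ij by simp
  finally show ?thesis using ij by (intro exI[of _ ?c]) auto
qed

end

section \<open>Generalized eigenspaces of a linear operator\<close>

locale finite_dimensional_operator = finite_dimensional_vector_space scale Basis
  for scale :: "'f::alg_closed_field \<Rightarrow> 'a::ab_group_add \<Rightarrow> 'a"
    and Basis :: "'a set" +
  fixes d :: "'a \<Rightarrow> 'a"
  assumes linear_op: "Vector_Spaces.linear scale scale d"
begin

lemma op_add: "d (x + y) = d x + d y"
  and op_scale: "d (scale c x) = scale c (d x)"
  using linear_op by (simp_all add: Vector_Spaces.linear_iff_module_hom module_hom_iff)

lemma op_zero [simp]: "d 0 = 0"
  using op_scale[of 0 0] by simp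

lemma op_diff: "d (x - y) = d x - d y"
  using op_add[of "x - y" y] by simp

definition shift :: "'f \<Rightarrow> 'a \<Rightarrow> 'a" where
  "shift \<alpha> x = d x - scale \<alpha> x"

text \<open>Every scalar gets a space, which is zero unless the scalar is an eigenvalue; sums of
  weights may thus be formed freely.\<close>

definition gen_eigenspace :: "'f \<Rightarrow> 'a set" where
  "gen_eigenspace \<alpha> = {x. \<exists>n. (shift \<alpha> ^^ n) x = 0}"

lemma shift_add: "shift \<alpha> (x + y) = shift \<alpha> x + shift \<alpha> y"
  by (simp add: shift_def op_add scale_right_distrib)

lemma shift_scale: "shift \<alpha> (scale c x) = scale c (shift \<alpha> x)"
  by (simp add: shift_def op_scale scale_right_diff_distrib mult.commute)

lemma shift_diff: "shift \<alpha> (x - y) = shift \<alpha> x - shift \<alpha> y"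
  by (simp add: shift_def op_diff scale_right_diff_distrib)

lemma shift_zero [simp]: "shift \<alpha> 0 = 0"
  by (simp add: shift_def)

lemma shift_commute: "shift \<alpha> (shift \<beta> x) = shift \<beta> (shift \<alpha> x)"
proof -
  have "shift \<alpha> (shift \<beta> x) = d (d x) - scale \<beta> (d x) - scale \<alpha> (d x) + scale (\<alpha> * \<beta>) x" for \<alpha> \<beta>
    by (simp add: shift_def op_diff op_scale scale_right_diff_distrib)
  then show ?thesis by (simp add: mult.commute diff_right_commute)
qed

lemma shift_power_add: "(shift \<alpha> ^^ n) (x + y) = (shift \<alpha> ^^ n) x + (shift \<alpha> ^^ n) y"
  by (induction n) (simp_all add: shift_add)

lemma shift_power_scale: "(shift \<alpha> ^^ n) (scale c x) = scale c ((shift \<alpha> ^^ n) x)"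
  by (induction n) (simp_all add: shift_scale)

lemma shift_power_zero [simp]: "(shift \<alpha> ^^ n) 0 = 0"
  by (induction n) simp_all

lemma shift_power_sum: "(shift \<alpha> ^^ n) (sum f I) = (\<Sum>i\<in>I. (shift \<alpha> ^^ n) (f i))"
  by (induction I rule: infinite_finite_induct) (simp_all add: shift_power_add)

lemma shift_power_commute: "(shift \<alpha> ^^ n) (shift \<beta> x) = shift \<beta> ((shift \<alpha> ^^ n) x)"
  by (induction n) (simp_all add: shift_commute)

lemma shift_powers_commute:
  "(shift \<alpha> ^^ n) ((shift \<beta> ^^ m) x) = (shift \<beta> ^^ m) ((shift \<alpha> ^^ n) x)"
  by (induction m) (simp_all add: shift_power_commute)

lemma shift_power_mono:
  assumes "(shift \<alpha> ^^ n) x = 0" "n \<le> m"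
  shows "(shift \<alpha> ^^ m) x = 0"
proof -
  have "(shift \<alpha> ^^ m) x = (shift \<alpha> ^^ (m - n)) ((shift \<alpha> ^^ n) x)"
    using assms(2) by (metis comp_apply funpow_add le_add_diff_inverse2)
  with assms(1) show ?thesis by simp
qed

lemma subspace_gen_eigenspace: "subspace (gen_eigenspace \<alpha>)"
proof (rule subspaceI)
  fix x y assume "x \<in> gen_eigenspace \<alpha>" "y \<in> gen_eigenspace \<alpha>"
  then obtain n m where nm: "(shift \<alpha> ^^ n) x = 0" "(shift \<alpha> ^^ m) y = 0"
    unfolding gen_eigenspace_def by blast
  have "(shift \<alpha> ^^ max n m) (x + y) = 0"
    using shift_power_mono[OF nm(1), of "max n m"] shift_power_mono[OF nm(2), of "max n m"]
    by (simp add: shift_power_add)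
  then show "x + y \<in> gen_eigenspace \<alpha>" unfolding gen_eigenspace_def by blast
qed (auto simp: gen_eigenspace_def shift_power_scale)

lemma shift_power_in_gen_eigenspace:
  "x \<in> gen_eigenspace \<beta> \<Longrightarrow> (shift \<alpha> ^^ n) x \<in> gen_eigenspace \<beta>"
  unfolding gen_eigenspace_def by clarify (metis shift_powers_commute shift_power_zero)

text \<open>On the kernel of \<open>shift \<alpha>\<close> the operator \<open>shift \<beta>\<close>
  is the nonzero scalar \<open>\<alpha> - \<beta>\<close>, so no power of it kills a nonzero vector
  there.\<close>

lemma shift_inj_on_gen_eigenspace:
  assumes "\<beta> \<noteq> \<alpha>" "x \<in> gen_eigenspace \<beta>" "(shift \<alpha> ^^ n) x = 0"
  shows "x = 0"
  using assms(2,3)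
proof (induction n arbitrary: x)
  case (Suc n)
  have "shift \<beta> y = scale (\<alpha> - \<beta>) y" if "shift \<alpha> y = 0" for y
    using that by (simp add: shift_def scale_left_diff_distrib)
  then have *: "(shift \<beta> ^^ k) y = scale ((\<alpha> - \<beta>) ^ k) y" if "shift \<alpha> y = 0" for k y
    using that by (induction k) (simp_all add: shift_scale)
  let ?y = "(shift \<alpha> ^^ n) x"
  have "?y \<in> gen_eigenspace \<beta>" by (rule shift_power_in_gen_eigenspace[OF Suc.prems(1)])
  then obtain k where "(shift \<beta> ^^ k) ?y = 0" unfolding gen_eigenspace_def by blast
  with *[of ?y k] Suc.prems(2) assms(1) have "?y = 0" by simp
  with Suc show ?case by blast
qed simp

text \<open>A power of \<open>shift (w j)\<close> removes the summand at j and is injective on the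
  other eigenspaces, so induction applies to the shorter sum.\<close>

lemma gen_eigenspaces_independent:
  assumes "finite I" "inj_on w I" "\<And>i. i \<in> I \<Longrightarrow> f i \<in> gen_eigenspace (w i)"
    and "sum f I = 0" "i \<in> I"
  shows "f i = 0"
  using assms
proof (induction I arbitrary: f i rule: finite_induct)
  case (insert j I)
  obtain n where n: "(shift (w j) ^^ n) (f j) = 0"
    using insert.prems(2)[of j] unfolding gen_eigenspace_def by blast
  let ?g = "\<lambda>i. (shift (w j) ^^ n) (f i)"
  have "sum ?g (insert j I) = (shift (w j) ^^ n) (sum f (insert j I))"
    by (rule shift_power_sum[symmetric])
  with n insert.hyps insert.prems(3) have "sum ?g I = 0" by simp
  then have g: "?g k = 0" if "k \<in> I" for k
    using insert.IH[of ?g k] that insert.prems(1,2) shift_power_in_gen_eigenspace by simp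
  have zero: "f k = 0" if k: "k \<in> I" for k
  proof (rule shift_inj_on_gen_eigenspace)
    show "w k \<noteq> w j" using insert.prems(1) insert.hyps k by (auto simp: inj_on_def)
  qed (use g k insert.prems(2) in auto)
  with insert.prems(3) insert.hyps have "f j = 0" by simp
  with zero insert.prems(4) show ?case by blast
qed simp

section \<open>Polynomials in d applied to a vector (Horner's scheme), and spanning by generalized
  eigenspaces\<close>

definition poly_act :: "'f poly \<Rightarrow> 'a \<Rightarrow> 'a" where
  "poly_act p v = fold_coeffs (\<lambda>a w. scale a v + d w) p 0"

lemma poly_act_0 [simp]: "poly_act 0 v = 0"
  by (simp add: poly_act_def)

lemma poly_act_pCons [simp]: "poly_act (pCons a p) v = scale a v + d (poly_act p v)"
  by (cases "p = 0 \<and> a = 0") (auto simp: poly_act_def)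

lemma poly_act_add: "poly_act (p + q) v = poly_act p v + poly_act q v"
  by (induction p q rule: poly_induct2) (simp_all add: op_add scale_left_distrib algebra_simps)

lemma poly_act_smult: "poly_act (smult c p) v = scale c (poly_act p v)"
  by (induction p) (simp_all add: op_scale scale_right_distrib)

lemma poly_act_linear_factor: "poly_act ([:- a, 1:] * q) v = shift a (poly_act q v)"
  by (simp only: mult_pCons_left poly_act_add poly_act_smult poly_act_pCons) (simp add: shift_def)

lemma poly_act_monom: "poly_act (monom c n) v = scale c ((d ^^ n) v)"
  by (induction n) (simp_all add: monom_0 monom_Suc op_scale)

lemma poly_act_sum: "poly_act (sum f I) v = (\<Sum>i\<in>I. poly_act (f i) v)"
  by (induction I rule: infinite_finite_induct) (simp_all add: poly_act_add)

text \<open>The coefficients come from a linear relation among v, d v, ..., up to the power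
  \<open>dimension\<close> of d.\<close>

lemma annihilating_poly_exists: "\<exists>p. p \<noteq> 0 \<and> poly_act p v = 0"
proof -
  obtain c i where c: "i \<le> dimension" "c i \<noteq> 0"
    and sum: "(\<Sum>k\<le>dimension. scale (c k) ((d ^^ k) v)) = 0"
    using sequence_dependent[of "\<lambda>k. (d ^^ k) v"] by blast
  let ?p = "\<Sum>k\<le>dimension. monom (c k) k"
  have "coeff ?p i = c i" using c(1) by (simp add: coeff_sum)
  with c(2) have "?p \<noteq> 0" by fastforce
  moreover have "poly_act ?p v = 0" using sum by (simp add: poly_act_sum poly_act_monom)
  ultimately show ?thesis by blast
qed

text \<open>Start from p with \<open>p(d) v = 0\<close>, which lies in M. Splitting p into linear
  factors, \<open>closed\<close> strips them off one by one until a nonzero multiple of v remains in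
  M.\<close>

lemma shift_closed_imp_UNIV:
  assumes M: "subspace M" and closed: "\<And>\<alpha> u. shift \<alpha> u \<in> M \<Longrightarrow> u \<in> M"
  shows "M = UNIV"
proof -
  have "v \<in> M" if "p \<noteq> 0" "poly_act p v \<in> M" for p v
    using that
  proof (induction "degree p" arbitrary: p)
    case 0
    then obtain c where "p = [:c:]" "c \<noteq> 0" by (metis degree_eq_zeroE pCons_0_0)
    with 0 subspace_scale[OF M, of "scale c v" "inverse c"] show ?case by simp
  next
    case (Suc n)
    then obtain a where "poly p a = 0" using alg_closed_imp_poly_has_root[of p] by auto
    then obtain q where q: "p = [:- a, 1:] * q" by (metis poly_eq_0_iff_dvd dvdE)
    with Suc.prems have "q \<noteq> 0" by auto
    moreover from this have "n = degree q" using Suc.hyps(2) unfolding q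
      by (subst (asm) degree_mult_eq) auto
    moreover have "poly_act q v \<in> M"
      using Suc.prems(2) closed unfolding q poly_act_linear_factor by blast
    ultimately show ?case using Suc.hyps(1) by blast
  qed
  then show ?thesis
    using annihilating_poly_exists subspace_0[OF M] by (metis UNIV_eq_I)
qed

text \<open>Each x in the span M is \<open>shift \<alpha> v + g\<close> with v in M and g of weight
  \<open>\<alpha>\<close>. If x = \<open>shift \<alpha> u\<close>, then \<open>u - v\<close> has
  weight \<open>\<alpha>\<close>, so u is in M and the previous lemma applies.\<close>

theorem span_gen_eigenspaces: "span (\<Union>\<alpha>. gen_eigenspace \<alpha>) = UNIV"
proof (rule shift_closed_imp_UNIV)
  let ?M = "span (\<Union>\<alpha>. gen_eigenspace \<alpha>)"
  have base: "x \<in> ?M" if "x \<in> gen_eigenspace \<beta>" for x \<beta>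
    using that by (auto intro: span_base)
  fix \<alpha> u assume u: "shift \<alpha> u \<in> ?M"
  \<comment> \<open>If \<open>shift \<beta> x = shift \<alpha> v\<close>, then subtracting from
    \<open>shift \<alpha> x\<close> gives
    \<open>shift \<alpha> (x - v) = (\<beta> - \<alpha>) x\<close>, and division yields a preimage
    of x.\<close>
  have preimage: "\<exists>v\<in>?M. x = shift \<alpha> v" if "\<beta> \<noteq> \<alpha>" "(shift \<beta> ^^ n) x = 0" for \<beta> n x
    using that(2)
  proof (induction n arbitrary: x)
    case 0
    then show ?case using span_zero by (intro bexI[of _ 0]) auto
  next
    case (Suc n)
    then have "(shift \<beta> ^^ n) (shift \<beta> x) = 0" by (simp add: shift_power_commute)
    then obtain v where v: "v \<in> ?M" "shift \<beta> x = shift \<alpha> v" using Suc.IH by blast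
    let ?c = "inverse (\<beta> - \<alpha>)"
    have "shift \<alpha> (x - v) = shift \<alpha> x - shift \<alpha> v" by (rule shift_diff)
    also have "\<dots> = scale (\<beta> - \<alpha>) x"
      unfolding v(2)[symmetric] by (simp add: shift_def scale_left_diff_distrib)
    finally have "shift \<alpha> (scale ?c (x - v)) = x"
      unfolding shift_scale using that(1) by simp
    moreover have "x \<in> ?M" using Suc.prems base unfolding gen_eigenspace_def by blast
    ultimately show ?case using v(1) by (metis span_diff span_scale)
  qed
  let ?S = "{shift \<alpha> v + g | v g. v \<in> ?M \<and> g \<in> gen_eigenspace \<alpha>}"
  have "?M \<subseteq> ?S"
  proof (rule span_minimal)
    show "(\<Union>\<alpha>. gen_eigenspace \<alpha>) \<subseteq> ?S"
    proof safe
      fix x \<beta> assume x: "x \<in> gen_eigenspace \<beta>"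
      show "\<exists>v g. x = shift \<alpha> v + g \<and> v \<in> ?M \<and> g \<in> gen_eigenspace \<alpha>"
      proof (cases "\<beta> = \<alpha>")
        case True
        with x show ?thesis using span_zero by (intro exI[of _ 0] exI[of _ x]) auto
      next
        case False
        with x preimage obtain v where "v \<in> ?M" "x = shift \<alpha> v"
          unfolding gen_eigenspace_def by blast
        then show ?thesis using subspace_0[OF subspace_gen_eigenspace]
          by (intro exI[of _ v] exI[of _ 0]) auto
      qed
    qed
  next
    show "subspace ?S"
    proof (rule subspaceI)
      have "0 = shift \<alpha> 0 + 0" by simp
      then show "0 \<in> ?S" using span_zero subspace_0[OF subspace_gen_eigenspace] by blast
    next
      fix x y assume "x \<in> ?S" "y \<in> ?S"
      then obtain v g v' g' where "x = shift \<alpha> v + g" "y = shift \<alpha> v' + g'" and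
        mem: "v \<in> ?M" "g \<in> gen_eigenspace \<alpha>" "v' \<in> ?M" "g' \<in> gen_eigenspace \<alpha>" by blast
      then have "x + y = shift \<alpha> (v + v') + (g + g')" by (simp add: shift_add algebra_simps)
      with mem show "x + y \<in> ?S"
        using span_add subspace_add[OF subspace_gen_eigenspace] by blast
    next
      fix c x assume "x \<in> ?S"
      then obtain v g where "x = shift \<alpha> v + g" and
        mem: "v \<in> ?M" "g \<in> gen_eigenspace \<alpha>" by blast
      then have "scale c x = shift \<alpha> (scale c v) + scale c g"
        by (simp add: shift_scale scale_right_distrib)
      with mem show "scale c x \<in> ?S"
        using span_scale subspace_scale[OF subspace_gen_eigenspace] by blast
    qed
  qed
  with u obtain v g where v: "v \<in> ?M" "shift \<alpha> u = shift \<alpha> v + g" and g: "g \<in> gen_eigenspace \<alpha>"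
    by blast
  have "shift \<alpha> (u - v) = g" unfolding shift_diff v(2) by simp
  moreover obtain n where "(shift \<alpha> ^^ n) g = 0" using g unfolding gen_eigenspace_def by blast
  ultimately have "(shift \<alpha> ^^ Suc n) (u - v) = 0"
    unfolding funpow_Suc_right comp_apply by simp
  then have "u - v \<in> ?M" using base unfolding gen_eigenspace_def by blast
  from span_add[OF this v(1)] show "u \<in> ?M" by simp
qed simp

end

section \<open>Weights of a derivation and the nilpotency theorem\<close>

locale leibniz_algebra_with_derivation =
  finite_dimensional_leibniz_algebra scale bracket Basis +
  finite_dimensional_operator scale Basis d
  for scale :: "'f::{alg_closed_field, field_char_0} \<Rightarrow> 'a::ab_group_add \<Rightarrow> 'a"
    and bracket :: "'a \<Rightarrow> 'a \<Rightarrow> 'a" and Basis :: "'a set" and d :: "'a \<Rightarrow> 'a" +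
  assumes op_bracket: "d (bracket x y) = bracket (d x) y + bracket x (d y)"
begin

text \<open>Subtract \<open>(\<alpha> + \<beta>) [x,y] = [\<alpha> x, y] + [x, \<beta> y]\<close>
  from the derivation rule.\<close>

lemma shift_bracket:
  "shift (\<alpha> + \<beta>) (bracket x y) = bracket (shift \<alpha> x) y + bracket x (shift \<beta> y)"
proof -
  have "bracket (d x) y = bracket (shift \<alpha> x) y + scale \<alpha> (bracket x y)"
    unfolding bracket_scale_left[symmetric] bracket_add_left[symmetric] by (simp add: shift_def)
  moreover have "bracket x (d y) = bracket x (shift \<beta> y) + scale \<beta> (bracket x y)"
    unfolding bracket_scale_right[symmetric] bracket_add_right[symmetric] by (simp add: shift_def)
  ultimately show ?thesis
    by (simp add: shift_def[of "\<alpha> + \<beta>"] op_bracket scale_left_distrib)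
qed

text \<open>Induction on the sum of the two nilpotency exponents: each application of the shift
  lowers one of them, and at exponent 0 the corresponding factor is zero.\<close>

lemma bracket_gen_eigenspace:
  assumes "x \<in> gen_eigenspace \<alpha>" "y \<in> gen_eigenspace \<beta>"
  shows "bracket x y \<in> gen_eigenspace (\<alpha> + \<beta>)"
proof -
  have "(shift (\<alpha> + \<beta>) ^^ s) (bracket x y) = 0"
    if "(shift \<alpha> ^^ m) x = 0" "(shift \<beta> ^^ n) y = 0" "m + n = s" for s m n x y
    using that
  proof (induction s arbitrary: m n x y)
    case (Suc s)
    show ?case
    proof (cases "m = 0 \<or> n = 0")
      case True
      then have "x = 0 \<or> y = 0" using Suc.prems by auto
      then have "bracket x y = 0" by auto
      then show ?thesis by (metis shift_power_zero)
    next
      case False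
      then obtain m' n' where mn: "m = Suc m'" "n = Suc n'" by (metis not0_implies_Suc)
      have "(shift (\<alpha> + \<beta>) ^^ s) (bracket (shift \<alpha> x) y) = 0"
        using Suc.prems mn by (intro Suc.IH[of m' _ n]) (auto simp: shift_power_commute)
      moreover have "(shift (\<alpha> + \<beta>) ^^ s) (bracket x (shift \<beta> y)) = 0"
        using Suc.prems mn by (intro Suc.IH[of m _ n']) (auto simp: shift_power_commute)
      ultimately show ?thesis
        unfolding funpow_Suc_right comp_apply shift_bracket shift_power_add by simp
    qed
  qed simp
  with assms show ?thesis unfolding gen_eigenspace_def by blast
qed

text \<open>The vectors \<open>x, [x,h], [[x,h],h], \<dots>\<close> have pairwise distinct weights
  \<open>\<alpha> + k \<beta>\<close>, so they cannot all be nonzero.\<close>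

lemma right_mult_nilpotent:
  assumes h: "h \<in> gen_eigenspace \<beta>" and "\<beta> \<noteq> 0"
  shows "((\<lambda>x. bracket x h) ^^ dimension) x = 0"
proof -
  let ?R = "\<lambda>k. (\<lambda>x. bracket x h) ^^ k"
  have homogeneous: "?R dimension x = 0" if x: "x \<in> gen_eigenspace \<alpha>" for x \<alpha>
  proof -
    have weight: "?R k x \<in> gen_eigenspace (\<alpha> + of_nat k * \<beta>)" for k
    proof (induction k)
      case (Suc k)
      from bracket_gen_eigenspace[OF Suc h] show ?case by (simp add: algebra_simps)
    qed (simp add: x)
    obtain c i where c: "i \<le> dimension" "c i \<noteq> 0"
      and sum: "(\<Sum>k\<le>dimension. scale (c k) (?R k x)) = 0"
      using sequence_dependent[of "\<lambda>k. ?R k x"] by blast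
    have "scale (c i) (?R i x) = 0"
    proof (rule gen_eigenspaces_independent[where f = "\<lambda>k. scale (c k) (?R k x)"])
      \<comment> \<open>Here characteristic 0 enters: for \<open>\<beta> \<noteq> 0\<close> the
        multiples of \<open>\<beta>\<close> are distinct.\<close>
      show "inj_on (\<lambda>k. \<alpha> + of_nat k * \<beta>) {..dimension}"
        using assms(2) by (auto simp: inj_on_def)
    qed (use sum c(1) subspace_scale[OF subspace_gen_eigenspace weight] in auto)
    with c(2) have "?R i x = 0" by simp
    moreover have "?R dimension x = ?R (dimension - i) (?R i x)"
      using c(1) by (metis comp_apply funpow_add le_add_diff_inverse2)
    ultimately show ?thesis by (simp add: right_mult_power_zero)
  qed
  \<comment> \<open>The exponent \<open>dimension\<close> is the same for all homogeneous x, so the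
    vanishing extends linearly.\<close>
  have "span (\<Union>\<alpha>. gen_eigenspace \<alpha>) \<subseteq> {x. ?R dimension x = 0}"
  proof (rule span_minimal)
    show "subspace {x. ?R dimension x = 0}"
      unfolding subspace_def
      by (simp add: right_mult_power_zero right_mult_power_add right_mult_power_scale)
  qed (use homogeneous in blast)
  then show ?thesis unfolding span_gen_eigenspaces by blast
qed

text \<open>The homogeneous elements serve as H: they span, and they are closed under brackets
  because weights add.\<close>

theorem nilpotent_if_derivation_inj:
  assumes "inj d"
  shows nilpotent
proof (rule nilpotent_if_spanned_by_nilpotents)
  show "span (\<Union>\<alpha>. gen_eigenspace \<alpha>) = UNIV" by (rule span_gen_eigenspaces)
next
  fix x y assume "x \<in> (\<Union>\<alpha>. gen_eigenspace \<alpha>)" "y \<in> (\<Union>\<alpha>. gen_eigenspace \<alpha>)"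
  then show "bracket x y \<in> (\<Union>\<alpha>. gen_eigenspace \<alpha>)" using bracket_gen_eigenspace by blast
next
  fix h assume "h \<in> (\<Union>\<alpha>. gen_eigenspace \<alpha>)"
  then obtain \<beta> where h: "h \<in> gen_eigenspace \<beta>" by blast
  show "\<exists>m. \<forall>x. ((\<lambda>x. bracket x h) ^^ m) x = 0"
  proof (cases "\<beta> = 0")
    case True
    \<comment> \<open>\<open>shift 0\<close> is d itself, so injectivity leaves only the zero vector
      in weight 0, and right multiplication by it is zero.\<close>
    have "d y = 0 \<Longrightarrow> y = 0" for y using injD[OF assms, of y 0] by simp
    then have "(shift 0 ^^ n) y = 0 \<Longrightarrow> y = 0" for n y
      by (induction n) (auto simp: shift_def)
    with h True have "h = 0" unfolding gen_eigenspace_def by blast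
    then show ?thesis by (intro exI[of _ 1]) simp
  next
    case False
    with right_mult_nilpotent[OF h] show ?thesis by blast
  qed
qed

end

theorem theorem3p8:
  fixes scale :: "complex \<Rightarrow> 'a::ab_group_add \<Rightarrow> 'a"
    and bracket :: "'a \<Rightarrow> 'a \<Rightarrow> 'a"
  assumes "leibniz_algebra scale bracket"
    and "\<exists>B. finite_dimensional_vector_space scale B"
    and "\<exists>d. leibniz_algebra.derivation scale bracket d \<and> bij d"
  shows "leibniz_algebra.nilpotent scale bracket"
proof -
  obtain B d where B: "finite_dimensional_vector_space scale B"
    and d: "leibniz_algebra.derivation scale bracket d" "bij d"
    using assms by blast
  \<comment> \<open>The field \<open>complex\<close> has characteristic 0 and is algebraically
    closed by the fundamental theorem of algebra.\<close>
  have "leibniz_algebra_with_derivation scale bracket B d"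
    using assms(1) B d(1)
    unfolding leibniz_algebra_with_derivation_def leibniz_algebra_with_derivation_axioms_def
      finite_dimensional_leibniz_algebra_def finite_dimensional_operator_def
      finite_dimensional_operator_axioms_def leibniz_algebra.derivation_def[OF assms(1)]
    by blast
  then show ?thesis
    using leibniz_algebra_with_derivation.nilpotent_if_derivation_inj bij_is_inj[OF d(2)] by blast
qed

end
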